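(* Let $\kappa$ be an infinite cardinal, possibly singular, and let $l=(Fm_\Sigma(X),\vdash)$ be a logic of cardinality at most $\kappa$. Then the canonical filter pair $(Fi_l,i)$ of $l$ is a $reg(\kappa)$-filter pair, where $reg(\kappa)$ denotes the least regular cardinal $\geq\kappa$.
   Context: A logic $(Fm_\Sigma(X),\vdash)$: $\Sigma$ a signature of operation symbols, $X$ an infinite set, $\vdash$ a reflexive, monotone, cut-closed, structural relation between subsets and elements of the absolutely free algebra $Fm_\Sigma(X)$; it has cardinality at most $\kappa$ if whenever $\Gamma\vdash\varphi$ some $\Gamma'\subseteq\Gamma$ with $|\Gamma'|<\kappa$ has $\Gamma'\vdash\varphi$. An $l$-filter on a $\Sigma$-algebra $A$ is $F\subseteq A$ such that $\Gamma\vdash\varphi$, $v\colon Fm_\Sigma(X)\to A$ a homomorphism, $v(\Gamma)\subseteq F$ imply $v(\varphi)\in F$. The canonical filter pair is $(Fi_l,i)$ with $Fi_l(A)$ the lattice of $l$-filters on $A$, $Fi_l(h)=h^{-1}$ for homomorphisms $h$, and $i_A$ the inclusion into $\wp(A)$. For a regular cardinal $\lambda$, a $\lambda$-filter pair over $\Sigma$ is a pair $(G,i)$ where $G$ is a contravariant functor from $\Sigma$-algebras to $\lambda$-presentable lattices (complete lattices in which each element is a supremum of $\lambda$-small elements, $x$ being $\lambda$-small if $x\le\sup D$ for $\lambda$-directed $D$ implies $x\le d$ for some $d\in D$; $D$ is $\lambda$-directed if each subset of size $<\lambda$ has an upper bound in $D$), and $i_M\colon G(M)\to\wp(M)$ are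 order preserving maps preserving arbitrary infima and $\lambda$-directed suprema with $i_M\circ G(h)=h^{-1}\circ i_N$ for all homomorphisms $h\colon M\to N$. *)

theory Defs
  imports "HOL-Algebra.Complete_Lattice"
begin

unbundle cardinal_syntax

section \<open>Regular cardinals\<close>

text \<open>
  Cardinals are represented, as in \<^theory>\<open>HOL.BNF_Cardinal_Arithmetic\<close>, by well-order relations
  \<^term>\<open>r\<close> with \<^term>\<open>Card_order r\<close>; \<^term>\<open>Cinfinite r\<close> says that \<^term>\<open>r\<close> is an infinite cardinal.
\<close>

definition regular_cardinal :: "'k rel \<Rightarrow> bool" where
  "regular_cardinal r \<longleftrightarrow> Cinfinite r \<and> regularCard r"

text \<open>
  The competitors \<open>\<mu>\<close> range over cardinals on the type carrying \<open>r\<close>. This is no restriction, since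
  every cardinal below \<open>r\<close> has a copy on that type (an initial segment of \<open>r\<close>); see
  \<open>least_regular_above_global\<close> below.
\<close>
definition least_regular_above :: "'k rel \<Rightarrow> 'l rel \<Rightarrow> bool" where
  "least_regular_above \<kappa> r \<longleftrightarrow>
     regular_cardinal r \<and> \<kappa> \<le>o r \<and>
     (\<forall>\<mu> :: 'l rel. regular_cardinal \<mu> \<and> \<kappa> \<le>o \<mu> \<longrightarrow> r \<le>o \<mu>)"

text \<open>
  The least regular cardinal \<open>\<ge> \<kappa>\<close> may be the successor of \<open>\<kappa>\<close>, so it is
  placed on \<^typ>\<open>'k set\<close>, like \<^const>\<open>cardSuc\<close>.
\<close>
definition reg :: "'k rel \<Rightarrow> 'k set rel" where
  "reg \<kappa> = (SOME r. least_regular_above \<kappa> r)"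

lemma ex_regular_above:
  fixes \<kappa> :: "'k rel"
  assumes "Cinfinite \<kappa>"
  obtains r :: "'k set rel" where "regular_cardinal r" "\<kappa> \<le>o r"
    "\<And>\<mu> :: 'm rel. regular_cardinal \<mu> \<Longrightarrow> \<kappa> \<le>o \<mu> \<Longrightarrow> r \<le>o \<mu>"
    "\<And>\<mu> :: 'k set rel. regular_cardinal \<mu> \<Longrightarrow> \<kappa> \<le>o \<mu> \<Longrightarrow> r \<le>o \<mu>"
proof (cases "regularCard \<kappa>")
  case True
  define r where "r = |(\<lambda>x. {x}) ` Field \<kappa>|"
  have "|Field \<kappa>| =o r"
    unfolding r_def
    by (rule card_of_ordIsoI[where f = "\<lambda>x. {x}"]) (auto simp: bij_betw_def)
  moreover have "|Field \<kappa>| =o \<kappa>"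
    using assms by (simp add: card_of_Field_ordIso)
  ultimately have iso: "\<kappa> =o r"
    using ordIso_symmetric ordIso_transitive by blast
  have "regular_cardinal r"
    using iso True assms regularCard_ordIso Cinfinite_cong
    unfolding regular_cardinal_def by blast
  moreover have "\<kappa> \<le>o r"
    using iso by (rule ordIso_imp_ordLeq)
  ultimately show ?thesis
    by (rule that) (use iso ordIso_symmetric ordIso_ordLeq_trans in blast)+
next
  case False
  have suc: "regular_cardinal (cardSuc \<kappa>)"
    using assms Cinfinite_cardSuc regularCard_cardSuc unfolding regular_cardinal_def by blast
  have above: "\<kappa> \<le>o cardSuc \<kappa>"
    using assms cardSuc_ordLeq by blast
  have least: "cardSuc \<kappa> \<le>o \<mu>" if "regular_cardinal \<mu>" "\<kappa> \<le>o \<mu>" for \<mu> :: "'n rel"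
  proof -
    have "\<not> \<mu> =o \<kappa>"
      using that False regularCard_ordIso unfolding regular_cardinal_def by blast
    then have "\<kappa> <o \<mu>"
      using that(2) ordLeq_iff_ordLess_or_ordIso ordIso_symmetric by blast
    then show ?thesis
      using that(1) assms cardSuc_least unfolding regular_cardinal_def by blast
  qed
  show ?thesis
    by (rule that[OF suc above least least])
qed

lemma least_regular_above_reg:
  assumes "Cinfinite \<kappa>"
  shows "least_regular_above \<kappa> (reg \<kappa>)"
proof -
  obtain r :: "'a set rel" where "regular_cardinal r" "\<kappa> \<le>o r"
    "\<And>\<mu> :: 'a set rel. regular_cardinal \<mu> \<Longrightarrow> \<kappa> \<le>o \<mu> \<Longrightarrow> r \<le>o \<mu>"
    by (rule ex_regular_above[OF assms]) (rule that)
  then have "\<exists>r :: 'a set rel. least_regular_above \<kappa> r"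
    unfolding least_regular_above_def by blast
  then show ?thesis
    unfolding reg_def by (rule someI_ex)
qed

lemma least_regular_above_global:
  fixes \<mu> :: "'m rel"
  assumes "Cinfinite \<kappa>" "regular_cardinal \<mu>" "\<kappa> \<le>o \<mu>"
  shows "reg \<kappa> \<le>o \<mu>"
proof -
  obtain r :: "'a set rel" where r: "regular_cardinal r" "\<kappa> \<le>o r"
    "\<And>\<mu> :: 'm rel. regular_cardinal \<mu> \<Longrightarrow> \<kappa> \<le>o \<mu> \<Longrightarrow> r \<le>o \<mu>"
    by (rule ex_regular_above[OF assms(1)]) (rule that)
  have "reg \<kappa> \<le>o r"
    using least_regular_above_reg[OF assms(1)] r(1,2) unfolding least_regular_above_def by blast
  then show ?thesis
    using r(3)[OF assms(2,3)] ordLeq_transitive by blast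
qed


section \<open>Signatures, algebras and formulas\<close>

record 'f signature =
  ops :: "'f set"
  arity :: "'f \<Rightarrow> nat"

record ('f, 'a) alg = "'a partial_object" +
  interp :: "'f \<Rightarrow> 'a list \<Rightarrow> 'a"

definition is_algebra :: "'f signature \<Rightarrow> ('f, 'a) alg \<Rightarrow> bool" where
  "is_algebra \<Sigma> A \<longleftrightarrow>
     (\<forall>f \<in> ops \<Sigma>. \<forall>xs. length xs = arity \<Sigma> f \<and> set xs \<subseteq> carrier A \<longrightarrow> interp A f xs \<in> carrier A)"

text \<open>
  Homomorphisms are extensional functions, so that equality in HOL is equality of
  homomorphisms as maps between the carriers.
\<close>
definition alg_hom :: "'f signature \<Rightarrow> ('f, 'a) alg \<Rightarrow> ('f, 'b) alg \<Rightarrow> ('a \<Rightarrow> 'b) set" where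
  "alg_hom \<Sigma> A B =
     {h \<in> carrier A \<rightarrow>\<^sub>E carrier B.
        \<forall>f \<in> ops \<Sigma>. \<forall>xs. length xs = arity \<Sigma> f \<and> set xs \<subseteq> carrier A \<longrightarrow>
          h (interp A f xs) = interp B f (map h xs)}"

datatype ('f, 'x) fm = Var 'x | Op 'f "('f, 'x) fm list"

inductive_set formulas :: "'f signature \<Rightarrow> 'x set \<Rightarrow> ('f, 'x) fm set"
  for \<Sigma> :: "'f signature" and X :: "'x set" where
  Var: "x \<in> X \<Longrightarrow> Var x \<in> formulas \<Sigma> X"
| Op: "\<lbrakk>f \<in> ops \<Sigma>; length \<phi>s = arity \<Sigma> f; \<forall>\<phi> \<in> set \<phi>s. \<phi> \<in> formulas \<Sigma> X\<rbrakk>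
       \<Longrightarrow> Op f \<phi>s \<in> formulas \<Sigma> X"

definition Fm :: "'f signature \<Rightarrow> 'x set \<Rightarrow> ('f, ('f, 'x) fm) alg" where
  "Fm \<Sigma> X = \<lparr>carrier = formulas \<Sigma> X, interp = Op\<rparr>"


section \<open>Logics and their filters\<close>

definition is_logic :: "'f signature \<Rightarrow> 'x set \<Rightarrow> (('f, 'x) fm set \<Rightarrow> ('f, 'x) fm \<Rightarrow> bool) \<Rightarrow> bool" where
  "is_logic \<Sigma> X entails \<longleftrightarrow>
     infinite X \<and>
     (\<forall>\<Gamma> \<phi>. entails \<Gamma> \<phi> \<longrightarrow> \<Gamma> \<subseteq> carrier (Fm \<Sigma> X) \<and> \<phi> \<in> carrier (Fm \<Sigma> X)) \<and>
     \<comment> \<open>reflexivity\<close>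
     (\<forall>\<Gamma> \<phi>. \<Gamma> \<subseteq> carrier (Fm \<Sigma> X) \<and> \<phi> \<in> \<Gamma> \<longrightarrow> entails \<Gamma> \<phi>) \<and>
     \<comment> \<open>monotonicity\<close>
     (\<forall>\<Gamma> \<Delta> \<phi>. entails \<Gamma> \<phi> \<and> \<Gamma> \<subseteq> \<Delta> \<and> \<Delta> \<subseteq> carrier (Fm \<Sigma> X) \<longrightarrow> entails \<Delta> \<phi>) \<and>
     \<comment> \<open>cut; \<open>\<Gamma>\<close> is restricted to sets of formulas for the case \<open>\<Delta> = \<emptyset>\<close>\<close>
     (\<forall>\<Gamma> \<Delta> \<phi>. \<Gamma> \<subseteq> carrier (Fm \<Sigma> X) \<and> (\<forall>\<psi> \<in> \<Delta>. entails \<Gamma> \<psi>) \<and> entails \<Delta> \<phi> \<longrightarrow> entails \<Gamma> \<phi>) \<and>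
     \<comment> \<open>structurality\<close>
     (\<forall>\<Gamma> \<phi> \<sigma>. entails \<Gamma> \<phi> \<and> \<sigma> \<in> alg_hom \<Sigma> (Fm \<Sigma> X) (Fm \<Sigma> X) \<longrightarrow> entails (\<sigma> ` \<Gamma>) (\<sigma> \<phi>))"

definition cardinality_at_most :: "(('f, 'x) fm set \<Rightarrow> ('f, 'x) fm \<Rightarrow> bool) \<Rightarrow> 'k rel \<Rightarrow> bool" where
  "cardinality_at_most entails \<kappa> \<longleftrightarrow>
     (\<forall>\<Gamma> \<phi>. entails \<Gamma> \<phi> \<longrightarrow> (\<exists>\<Gamma>' \<subseteq> \<Gamma>. |\<Gamma>'| <o \<kappa> \<and> entails \<Gamma>' \<phi>))"

definition l_filter ::
  "'f signature \<Rightarrow> 'x set \<Rightarrow> (('f, 'x) fm set \<Rightarrow> ('f, 'x) fm \<Rightarrow> bool) \<Rightarrow> ('f, 'a) alg \<Rightarrow> 'a set \<Rightarrow> bool" where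
  "l_filter \<Sigma> X entails A F \<longleftrightarrow>
     F \<subseteq> carrier A \<and>
     (\<forall>\<Gamma> \<phi> v. entails \<Gamma> \<phi> \<and> v \<in> alg_hom \<Sigma> (Fm \<Sigma> X) A \<and> v ` \<Gamma> \<subseteq> F \<longrightarrow> v \<phi> \<in> F)"


section \<open>Presentable lattices\<close>

definition directed_in :: "'r rel \<Rightarrow> 'b gorder \<Rightarrow> 'b set \<Rightarrow> bool" where
  "directed_in r L D \<longleftrightarrow>
     D \<subseteq> carrier L \<and> (\<forall>S \<subseteq> D. |S| <o r \<longrightarrow> (\<exists>d \<in> D. \<forall>s \<in> S. s \<sqsubseteq>\<^bsub>L\<^esub> d))"

definition small_in :: "'r rel \<Rightarrow> 'b gorder \<Rightarrow> 'b \<Rightarrow> bool" where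
  "small_in r L x \<longleftrightarrow>
     x \<in> carrier L \<and> (\<forall>D. directed_in r L D \<and> x \<sqsubseteq>\<^bsub>L\<^esub> \<Squnion>\<^bsub>L\<^esub> D \<longrightarrow> (\<exists>d \<in> D. x \<sqsubseteq>\<^bsub>L\<^esub> d))"

definition presentable_lattice :: "'r rel \<Rightarrow> 'b gorder \<Rightarrow> bool" where
  "presentable_lattice r L \<longleftrightarrow>
     complete_lattice L \<and>
     (\<forall>x \<in> carrier L. \<exists>S. (\<forall>s \<in> S. small_in r L s) \<and> x = \<Squnion>\<^bsub>L\<^esub> S)"


section \<open>Filter pairs\<close>

definition powerset_lattice :: "'a set \<Rightarrow> 'a set gorder" where
  "powerset_lattice A = \<lparr>carrier = Pow A, eq = (=), le = (\<subseteq>)\<rparr>"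

text \<open>
  A contravariant functor from the \<open>\<Sigma>\<close>-algebras with carrier in the type \<^typ>\<open>'a\<close> to
  \<open>r\<close>-presentable lattices and order preserving maps. It is given by its object part \<open>G\<close> and its
  morphism part, where \<open>Gmap M N h\<close> is the map from \<open>G N\<close> to \<open>G M\<close> induced by \<open>h : M \<rightarrow> N\<close>.
\<close>
definition presentable_lattice_functor ::
  "'r rel \<Rightarrow> 'f signature \<Rightarrow> (('f, 'a) alg \<Rightarrow> 'b gorder) \<Rightarrow>
   (('f, 'a) alg \<Rightarrow> ('f, 'a) alg \<Rightarrow> ('a \<Rightarrow> 'a) \<Rightarrow> 'b \<Rightarrow> 'b) \<Rightarrow> bool" where
  "presentable_lattice_functor r \<Sigma> G Gmap \<longleftrightarrow>
     (\<forall>M. is_algebra \<Sigma> M \<longrightarrow> presentable_lattice r (G M)) \<and>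
     (\<forall>M N h. is_algebra \<Sigma> M \<and> is_algebra \<Sigma> N \<and> h \<in> alg_hom \<Sigma> M N \<longrightarrow>
        Gmap M N h \<in> carrier (G N) \<rightarrow> carrier (G M) \<and> isotone (G N) (G M) (Gmap M N h)) \<and>
     (\<forall>M. is_algebra \<Sigma> M \<longrightarrow>
        (\<forall>y \<in> carrier (G M). Gmap M M (restrict id (carrier M)) y = y)) \<and>
     (\<forall>M N P g h. is_algebra \<Sigma> M \<and> is_algebra \<Sigma> N \<and> is_algebra \<Sigma> P \<and>
        h \<in> alg_hom \<Sigma> M N \<and> g \<in> alg_hom \<Sigma> N P \<longrightarrow>
        (\<forall>y \<in> carrier (G P). Gmap M P (compose (carrier M) g h) y = Gmap M N h (Gmap N P g y)))"

definition is_filter_pair ::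
  "'r rel \<Rightarrow> 'f signature \<Rightarrow> (('f, 'a) alg \<Rightarrow> 'b gorder) \<Rightarrow>
   (('f, 'a) alg \<Rightarrow> ('f, 'a) alg \<Rightarrow> ('a \<Rightarrow> 'a) \<Rightarrow> 'b \<Rightarrow> 'b) \<Rightarrow>
   (('f, 'a) alg \<Rightarrow> 'b \<Rightarrow> 'a set) \<Rightarrow> bool" where
  "is_filter_pair r \<Sigma> G Gmap i \<longleftrightarrow>
     regular_cardinal r \<and>
     presentable_lattice_functor r \<Sigma> G Gmap \<and>
     (\<forall>M. is_algebra \<Sigma> M \<longrightarrow>
        i M \<in> carrier (G M) \<rightarrow> carrier (powerset_lattice (carrier M)) \<and>
        isotone (G M) (powerset_lattice (carrier M)) (i M) \<and>
        (\<forall>S \<subseteq> carrier (G M). i M (\<Sqinter>\<^bsub>G M\<^esub> S) = \<Sqinter>\<^bsub>powerset_lattice (carrier M)\<^esub> (i M ` S)) \<and>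
        (\<forall>D. directed_in r (G M) D \<longrightarrow>
           i M (\<Squnion>\<^bsub>G M\<^esub> D) = \<Squnion>\<^bsub>powerset_lattice (carrier M)\<^esub> (i M ` D))) \<and>
     (\<forall>M N h. is_algebra \<Sigma> M \<and> is_algebra \<Sigma> N \<and> h \<in> alg_hom \<Sigma> M N \<longrightarrow>
        (\<forall>y \<in> carrier (G N). i M (Gmap M N h y) = h -` i N y \<inter> carrier M))"

definition Fi ::
  "'f signature \<Rightarrow> 'x set \<Rightarrow> (('f, 'x) fm set \<Rightarrow> ('f, 'x) fm \<Rightarrow> bool) \<Rightarrow> ('f, 'a) alg \<Rightarrow> 'a set gorder" where
  "Fi \<Sigma> X entails A = \<lparr>carrier = {F. l_filter \<Sigma> X entails A F}, eq = (=), le = (\<subseteq>)\<rparr>"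

definition Fi_map ::
  "('f, 'a) alg \<Rightarrow> ('f, 'a) alg \<Rightarrow> ('a \<Rightarrow> 'a) \<Rightarrow> 'a set \<Rightarrow> 'a set" where
  "Fi_map M N h F = h -` F \<inter> carrier M"

definition Fi_incl :: "('f, 'a) alg \<Rightarrow> 'a set \<Rightarrow> 'a set" where
  "Fi_incl M F = F"

end

theory Submission
  imports Defs
begin

text \<open>
  The key point is that a union of filters directed with respect to \<open>\<kappa>\<close>, or to any larger
  cardinal, is again a filter: fewer than \<open>\<kappa>\<close> premises of a consequence suffice, so they already
  lie in a single member of the family. Suprema of directed families of filters are therefore
  unions, whence each filter generated by a single element is small; and every filter is the
  supremum of the filters generated by its elements.
\<close>

section \<open>Families of sets ordered by inclusion\<close>

text \<open>Both \<open>Fi\<close> and \<open>powerset_lattice\<close> unfold to orders of this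
  shape, so one computation of suprema and infima serves the filter lattice and the powerset
  alike.\<close>

abbreviation inclusion_order :: "'a set set \<Rightarrow> 'a set gorder" where
  "inclusion_order C \<equiv> \<lparr>carrier = C, eq = (=), le = (\<subseteq>)\<rparr>"

lemma partial_order_inclusion_order: "partial_order (inclusion_order C)"
  by unfold_locales auto

text \<open>\<open>Upper\<close> tests only those members of \<open>S\<close> that lie in the
  carrier; with \<open>S \<subseteq> C\<close> these are all of them, and a condition purely about
  inclusions remains.\<close>

lemma least_Upper_inclusion_order_iff:
  assumes "S \<subseteq> C"
  shows "least (inclusion_order C) U (Upper (inclusion_order C) S) \<longleftrightarrow>
    U \<in> C \<and> (\<forall>F \<in> S. F \<subseteq> U) \<and> (\<forall>G \<in> C. (\<forall>F \<in> S. F \<subseteq> G) \<longrightarrow> U \<subseteq> G)"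
proof -
  have "Upper (inclusion_order C) S = {G \<in> C. \<forall>F \<in> S. F \<subseteq> G}"
    using assms unfolding Upper_def by auto
  then show ?thesis
    by (auto simp: least_def)
qed

lemma greatest_Lower_inclusion_order_iff:
  assumes "S \<subseteq> C"
  shows "greatest (inclusion_order C) U (Lower (inclusion_order C) S) \<longleftrightarrow>
    U \<in> C \<and> (\<forall>F \<in> S. U \<subseteq> F) \<and> (\<forall>G \<in> C. (\<forall>F \<in> S. G \<subseteq> F) \<longrightarrow> G \<subseteq> U)"
proof -
  have "Lower (inclusion_order C) S = {G \<in> C. \<forall>F \<in> S. G \<subseteq> F}"
    using assms unfolding Lower_def by auto
  then show ?thesis
    by (auto simp: greatest_def)
qed

text \<open>The supremum is a choice among least upper bounds; antisymmetry of inclusion leaves only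
  one candidate, so exhibiting it determines the value.\<close>

lemma inclusion_order_sup_eqI:
  assumes "U \<in> C" "\<And>F. F \<in> S \<Longrightarrow> F \<subseteq> U"
    and "\<And>G. G \<in> C \<Longrightarrow> (\<And>F. F \<in> S \<Longrightarrow> F \<subseteq> G) \<Longrightarrow> U \<subseteq> G"
    and "S \<subseteq> C"
  shows "\<Squnion>\<^bsub>inclusion_order C\<^esub> S = U"
  unfolding sup_def least_Upper_inclusion_order_iff[OF assms(4)]
proof (rule some_equality)
  show "U \<in> C \<and> (\<forall>F \<in> S. F \<subseteq> U) \<and> (\<forall>G \<in> C. (\<forall>F \<in> S. F \<subseteq> G) \<longrightarrow> U \<subseteq> G)"
    using assms(1-3) by blast
  then show "V = U"
    if "V \<in> C \<and> (\<forall>F \<in> S. F \<subseteq> V) \<and> (\<forall>G \<in> C. (\<forall>F \<in> S. F \<subseteq> G) \<longrightarrow> V \<subseteq> G)" for V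
    using that by (meson subset_antisym)
qed

lemma inclusion_order_inf_eqI:
  assumes "U \<in> C" "\<And>F. F \<in> S \<Longrightarrow> U \<subseteq> F"
    and "\<And>G. G \<in> C \<Longrightarrow> (\<And>F. F \<in> S \<Longrightarrow> G \<subseteq> F) \<Longrightarrow> G \<subseteq> U"
    and "S \<subseteq> C"
  shows "\<Sqinter>\<^bsub>inclusion_order C\<^esub> S = U"
  unfolding inf_def greatest_Lower_inclusion_order_iff[OF assms(4)]
proof (rule some_equality)
  show "U \<in> C \<and> (\<forall>F \<in> S. U \<subseteq> F) \<and> (\<forall>G \<in> C. (\<forall>F \<in> S. G \<subseteq> F) \<longrightarrow> G \<subseteq> U)"
    using assms(1-3) by blast
  then show "V = U"
    if "V \<in> C \<and> (\<forall>F \<in> S. V \<subseteq> F) \<and> (\<forall>G \<in> C. (\<forall>F \<in> S. G \<subseteq> F) \<longrightarrow> G \<subseteq> V)" for V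
    using that by (meson subset_antisym)
qed

text \<open>The factor \<open>A\<close> matters for \<open>S = {}\<close>: there
  \<open>\<Inter>S\<close> is the whole type, whereas the infimum is the top element
  \<open>A\<close>.\<close>

lemma inclusion_order_inf_eq_Inter:
  assumes "S \<subseteq> C" "C \<subseteq> Pow A" "A \<inter> \<Inter>S \<in> C"
  shows "\<Sqinter>\<^bsub>inclusion_order C\<^esub> S = A \<inter> \<Inter>S"
  by (rule inclusion_order_inf_eqI) (use assms in auto)

lemma inclusion_order_sup_eq_Union:
  assumes "S \<subseteq> C" "\<Union>S \<in> C"
  shows "\<Squnion>\<^bsub>inclusion_order C\<^esub> S = \<Union>S"
  by (rule inclusion_order_sup_eqI) (use assms in auto)

lemma complete_lattice_inclusion_order:
  assumes "C \<subseteq> Pow A" and Inter: "\<And>S. S \<subseteq> C \<Longrightarrow> A \<inter> \<Inter>S \<in> C"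
  shows "complete_lattice (inclusion_order C)"
proof -
  interpret partial_order "inclusion_order C"
    by (rule partial_order_inclusion_order)
  show ?thesis
  proof (rule complete_latticeI)
    fix S assume "S \<subseteq> carrier (inclusion_order C)"
    then have sub: "S \<subseteq> C"
      by simp
    show "\<exists>s. greatest (inclusion_order C) s (Lower (inclusion_order C) S)"
      unfolding greatest_Lower_inclusion_order_iff[OF sub]
      by (rule exI[of _ "A \<inter> \<Inter>S"]) (use Inter[OF sub] assms(1) in blast)
    \<comment> \<open>The supremum is the intersection of all upper bounds in \<open>C\<close>, so
      closure under intersections yields both halves of completeness.\<close>
    let ?U = "A \<inter> \<Inter>{F \<in> C. \<forall>G \<in> S. G \<subseteq> F}"
    have "?U \<in> C"
      by (rule Inter) blast
    then show "\<exists>s. least (inclusion_order C) s (Upper (inclusion_order C) S)"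
      unfolding least_Upper_inclusion_order_iff[OF sub]
      by (intro exI[of _ ?U]) (use sub assms(1) in blast)
  qed
qed

lemma isotone_inclusion_order:
  assumes "\<And>F G. F \<in> C \<Longrightarrow> G \<in> C \<Longrightarrow> F \<subseteq> G \<Longrightarrow> f F \<subseteq> f G"
  shows "isotone (inclusion_order C) (inclusion_order C') f"
  using assms by (intro isotoneI partial_order.axioms(1)[OF partial_order_inclusion_order]) auto


section \<open>Homomorphisms\<close>

lemma alg_hom_in_carrier:
  "h \<in> alg_hom \<Sigma> A B \<Longrightarrow> x \<in> carrier A \<Longrightarrow> h x \<in> carrier B"
  by (auto simp: alg_hom_def)

lemma is_algebra_Fm: "is_algebra \<Sigma> (Fm \<Sigma> X)"
  by (auto simp: is_algebra_def Fm_def intro!: formulas.Op)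

lemma alg_hom_compose:
  assumes "is_algebra \<Sigma> A" "v \<in> alg_hom \<Sigma> A B" "h \<in> alg_hom \<Sigma> B C"
  shows "compose (carrier A) h v \<in> alg_hom \<Sigma> A C"
proof -
  have "compose (carrier A) h v (interp A f xs) = interp C f (map (compose (carrier A) h v) xs)"
    if f: "f \<in> ops \<Sigma>" and len: "length xs = arity \<Sigma> f" and xs: "set xs \<subseteq> carrier A" for f xs
  proof -
    have vxs: "set (map v xs) \<subseteq> carrier B"
      using xs alg_hom_in_carrier[OF assms(2)] by auto
    \<comment> \<open>\<open>is_algebra\<close> keeps \<open>interp A f xs\<close> inside the
      carrier, where \<open>compose\<close> agrees with the ordinary composition; outside, it is
      \<open>undefined\<close>.\<close>
    have "compose (carrier A) h v (interp A f xs) = h (v (interp A f xs))"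
      using assms(1) f len xs by (simp add: is_algebra_def compose_def)
    also have "\<dots> = h (interp B f (map v xs))"
      using assms(2) f len xs by (simp add: alg_hom_def)
    also have "\<dots> = interp C f (map h (map v xs))"
      using assms(3) f len vxs by (simp add: alg_hom_def)
    also have "map h (map v xs) = map (compose (carrier A) h v) xs"
      using xs by (auto simp: compose_def)
    finally show ?thesis .
  qed
  moreover have "compose (carrier A) h v \<in> carrier A \<rightarrow>\<^sub>E carrier C"
    using assms(2,3) by (auto simp: compose_def dest!: alg_hom_in_carrier)
  ultimately show ?thesis
    by (simp add: alg_hom_def)
qed


section \<open>Filters of a logic\<close>

lemma is_logic_entails_carrier:
  assumes "is_logic \<Sigma> X entails" "entails \<Gamma> \<phi>"
  shows "\<Gamma> \<subseteq> carrier (Fm \<Sigma> X)" "\<phi> \<in> carrier (Fm \<Sigma> X)"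
proof -
  have "\<forall>\<Gamma> \<phi>. entails \<Gamma> \<phi> \<longrightarrow> \<Gamma> \<subseteq> carrier (Fm \<Sigma> X) \<and> \<phi> \<in> carrier (Fm \<Sigma> X)"
    using assms(1) unfolding is_logic_def by (elim conjE)
  then show "\<Gamma> \<subseteq> carrier (Fm \<Sigma> X)" "\<phi> \<in> carrier (Fm \<Sigma> X)"
    using assms(2) by blast+
qed

lemma l_filter_subset: "l_filter \<Sigma> X entails A F \<Longrightarrow> F \<subseteq> carrier A"
  by (simp add: l_filter_def)

lemma l_filterD:
  assumes "l_filter \<Sigma> X entails A F" "entails \<Gamma> \<phi>" "v \<in> alg_hom \<Sigma> (Fm \<Sigma> X) A" "v ` \<Gamma> \<subseteq> F"
  shows "v \<phi> \<in> F"
  using assms unfolding l_filter_def by metis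

lemma carrier_Fi: "carrier (Fi \<Sigma> X entails A) = {F. l_filter \<Sigma> X entails A F}"
  by (simp add: Fi_def)

lemma carrier_Fi_subset: "carrier (Fi \<Sigma> X entails A) \<subseteq> Pow (carrier A)"
  by (metis PowI carrier_Fi l_filter_subset mem_Collect_eq subsetI)

lemma le_Fi: "F \<sqsubseteq>\<^bsub>Fi \<Sigma> X entails A\<^esub> G \<longleftrightarrow> F \<subseteq> G"
  by (simp add: Fi_def)

section \<open>Closure of filters under intersections, preimages and directed unions\<close>

lemma l_filter_Inter:
  assumes "is_logic \<Sigma> X entails" "\<And>F. F \<in> S \<Longrightarrow> l_filter \<Sigma> X entails A F"
  shows "l_filter \<Sigma> X entails A (carrier A \<inter> \<Inter>S)"
  unfolding l_filter_def
proof (intro conjI allI impI)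
  fix \<Gamma> \<phi> v
  assume *: "entails \<Gamma> \<phi> \<and> v \<in> alg_hom \<Sigma> (Fm \<Sigma> X) A \<and> v ` \<Gamma> \<subseteq> carrier A \<inter> \<Inter>S"
  then have v: "entails \<Gamma> \<phi>" "v \<in> alg_hom \<Sigma> (Fm \<Sigma> X) A" "v ` \<Gamma> \<subseteq> carrier A \<inter> \<Inter>S"
    by simp_all
  \<comment> \<open>Needed separately because of \<open>S = {}\<close>, where the intersection is
    the whole algebra.\<close>
  have "v \<phi> \<in> carrier A"
    by (rule alg_hom_in_carrier[OF v(2) is_logic_entails_carrier(2)[OF assms(1) v(1)]])
  moreover have "v \<phi> \<in> F" if F: "F \<in> S" for F
    by (rule l_filterD[OF assms(2)[OF F] v(1,2)]) (use F v(3) in blast)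
  ultimately show "v \<phi> \<in> carrier A \<inter> \<Inter>S"
    by blast
qed simp

text \<open>A valuation \<open>v\<close> into \<open>A\<close> followed by \<open>h\<close> is a
  valuation into \<open>B\<close>, so the closure of \<open>F\<close> at that composite is the
  closure of the preimage at \<open>v\<close>.\<close>

lemma l_filter_preimage:
  assumes "is_logic \<Sigma> X entails" "h \<in> alg_hom \<Sigma> A B" "l_filter \<Sigma> X entails B F"
  shows "l_filter \<Sigma> X entails A (h -` F \<inter> carrier A)"
  unfolding l_filter_def
proof (intro conjI allI impI)
  fix \<Gamma> \<phi> v
  assume *: "entails \<Gamma> \<phi> \<and> v \<in> alg_hom \<Sigma> (Fm \<Sigma> X) A \<and> v ` \<Gamma> \<subseteq> h -` F \<inter> carrier A"
  then have v: "entails \<Gamma> \<phi>" "v \<in> alg_hom \<Sigma> (Fm \<Sigma> X) A" "v ` \<Gamma> \<subseteq> h -` F \<inter> carrier A"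
    by simp_all
  note car = is_logic_entails_carrier[OF assms(1) v(1)]
  let ?w = "compose (carrier (Fm \<Sigma> X)) h v"
  have "?w ` \<Gamma> \<subseteq> F"
    using v(3) car(1) by (auto simp: compose_def)
  then have "?w \<phi> \<in> F"
    by (rule l_filterD[OF assms(3) v(1) alg_hom_compose[OF is_algebra_Fm v(2) assms(2)]])
  then show "v \<phi> \<in> h -` F \<inter> carrier A"
    using car(2) alg_hom_in_carrier[OF v(2)] by (simp add: compose_def)
qed simp

lemma l_filter_directed_Union:
  assumes "cardinality_at_most entails \<kappa>" "\<kappa> \<le>o r" "directed_in r (Fi \<Sigma> X entails A) D"
  shows "l_filter \<Sigma> X entails A (\<Union>D)"
  unfolding l_filter_def
proof (intro conjI allI impI)
  have D: "l_filter \<Sigma> X entails A F" if "F \<in> D" for F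
    using assms(3) that by (auto simp: directed_in_def carrier_Fi)
  then show "\<Union>D \<subseteq> carrier A"
    unfolding l_filter_def by blast
  fix \<Gamma> \<phi> v
  assume *: "entails \<Gamma> \<phi> \<and> v \<in> alg_hom \<Sigma> (Fm \<Sigma> X) A \<and> v ` \<Gamma> \<subseteq> \<Union>D"
  then have v: "entails \<Gamma> \<phi>" "v \<in> alg_hom \<Sigma> (Fm \<Sigma> X) A" "v ` \<Gamma> \<subseteq> \<Union>D"
    by simp_all
  obtain \<Gamma>' where \<Gamma>': "\<Gamma>' \<subseteq> \<Gamma>" "|\<Gamma>'| <o \<kappa>" "entails \<Gamma>' \<phi>"
    using assms(1) v(1) unfolding cardinality_at_most_def by meson
  have "\<forall>\<gamma> \<in> \<Gamma>'. \<exists>F \<in> D. v \<gamma> \<in> F"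
    using v(3) \<Gamma>'(1) by blast
  \<comment> \<open>\<open>c\<close> chooses for each of the fewer than \<kappa> premises a member
    of \<open>D\<close> containing its value.\<close>
  then obtain c where c: "\<And>\<gamma>. \<gamma> \<in> \<Gamma>' \<Longrightarrow> c \<gamma> \<in> D \<and> v \<gamma> \<in> c \<gamma>"
    by metis
  have "|c ` \<Gamma>'| <o r"
    using ordLess_ordLeq_trans[OF ordLeq_ordLess_trans[OF card_of_image \<Gamma>'(2)] assms(2)] .
  moreover have "c ` \<Gamma>' \<subseteq> D"
    using c by blast
  \<comment> \<open>If \<open>\<Gamma>'\<close> is empty, directedness is applied to the empty
    subfamily; it still yields a member of \<open>D\<close>, so values of theorems lie in the union
    too.\<close>
  ultimately have "\<exists>F \<in> D. \<forall>G \<in> c ` \<Gamma>'. G \<sqsubseteq>\<^bsub>Fi \<Sigma> X entails A\<^esub> F"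
    using assms(3) unfolding directed_in_def by blast
  then obtain F where F: "F \<in> D" "\<forall>G \<in> c ` \<Gamma>'. G \<subseteq> F"
    unfolding le_Fi by blast
  then have "v ` \<Gamma>' \<subseteq> F"
    using c by blast
  then have "v \<phi> \<in> F"
    by (rule l_filterD[OF D[OF F(1)] \<Gamma>'(3) v(2)])
  then show "v \<phi> \<in> \<Union>D"
    using F(1) by blast
qed

section \<open>Filters generated by a set\<close>

definition generated_filter ::
  "'f signature \<Rightarrow> 'x set \<Rightarrow> (('f, 'x) fm set \<Rightarrow> ('f, 'x) fm \<Rightarrow> bool) \<Rightarrow> ('f, 'a) alg \<Rightarrow> 'a set \<Rightarrow> 'a set" where
  "generated_filter \<Sigma> X entails A B = carrier A \<inter> \<Inter>{F. l_filter \<Sigma> X entails A F \<and> B \<subseteq> F}"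

lemma l_filter_generated_filter:
  "is_logic \<Sigma> X entails \<Longrightarrow> l_filter \<Sigma> X entails A (generated_filter \<Sigma> X entails A B)"
  \<comment> \<open>The factor \<open>carrier A\<close> gives the definition the shape of
    \<open>l_filter_Inter\<close> and fixes its value when no filter contains
    \<open>B\<close>.\<close>
  unfolding generated_filter_def by (rule l_filter_Inter) auto

lemma generated_filter_superset:
  "B \<subseteq> carrier A \<Longrightarrow> B \<subseteq> generated_filter \<Sigma> X entails A B"
  by (auto simp: generated_filter_def)

lemma generated_filter_least:
  "l_filter \<Sigma> X entails A F \<Longrightarrow> B \<subseteq> F \<Longrightarrow> generated_filter \<Sigma> X entails A B \<subseteq> F"
  by (auto simp: generated_filter_def)

section \<open>Directed suprema and arbitrary infima of filters\<close>

lemma Fi_sup_directed: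
  assumes "cardinality_at_most entails \<kappa>" "\<kappa> \<le>o r" "directed_in r (Fi \<Sigma> X entails A) D"
  shows "\<Squnion>\<^bsub>Fi \<Sigma> X entails A\<^esub> D = \<Union>D"
  using l_filter_directed_Union[OF assms] assms(3)
  unfolding Fi_def by (intro inclusion_order_sup_eq_Union) (auto simp: directed_in_def)

lemma Fi_inf:
  assumes "is_logic \<Sigma> X entails" "S \<subseteq> carrier (Fi \<Sigma> X entails A)"
  shows "\<Sqinter>\<^bsub>Fi \<Sigma> X entails A\<^esub> S = carrier A \<inter> \<Inter>S"
proof -
  have "l_filter \<Sigma> X entails A (carrier A \<inter> \<Inter>S)"
    by (rule l_filter_Inter[OF assms(1)]) (use assms(2) in \<open>auto simp: Fi_def\<close>)
  then show ?thesis
    using assms(2) carrier_Fi_subset[of \<Sigma> X entails A] unfolding Fi_def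
    by (intro inclusion_order_inf_eq_Inter) auto
qed

section \<open>Presentability of the lattice of filters\<close>

lemma small_in_generated_filter:
  assumes "is_logic \<Sigma> X entails" "cardinality_at_most entails \<kappa>" "\<kappa> \<le>o r" "a \<in> carrier A"
  shows "small_in r (Fi \<Sigma> X entails A) (generated_filter \<Sigma> X entails A {a})"
  unfolding small_in_def
proof (intro conjI allI impI)
  let ?L = "Fi \<Sigma> X entails A" and ?g = "generated_filter \<Sigma> X entails A {a}"
  show "?g \<in> carrier ?L"
    using l_filter_generated_filter[OF assms(1)] by (simp add: Fi_def)
  fix D assume D: "directed_in r ?L D \<and> ?g \<sqsubseteq>\<^bsub>?L\<^esub> \<Squnion>\<^bsub>?L\<^esub> D"
  then have "?g \<subseteq> \<Union>D"
    using Fi_sup_directed[OF assms(2,3)] unfolding le_Fi by metis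
  \<comment> \<open>Only the generator has to be located: once \<open>a\<close> lies in a member
    \<open>F\<close> of \<open>D\<close>, minimality places the whole generated filter inside
    \<open>F\<close>.\<close>
  then obtain F where F: "F \<in> D" "a \<in> F"
    using generated_filter_superset[of "{a}" A] assms(4) by blast
  moreover have "l_filter \<Sigma> X entails A F"
    using D F(1) by (auto simp: directed_in_def carrier_Fi)
  ultimately show "\<exists>F \<in> D. ?g \<sqsubseteq>\<^bsub>?L\<^esub> F"
    using generated_filter_least[of \<Sigma> X entails A F "{a}"] unfolding le_Fi by blast
qed

text \<open>Minimality bounds every generated filter by \<open>F\<close>, and an upper bound of all
  of them contains each generator. For \<open>F = {}\<close> the family is empty, and its supremum
  is the empty filter.\<close>

lemma Fi_sup_generated_filters:
  assumes "is_logic \<Sigma> X entails" "l_filter \<Sigma> X entails A F"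
  shows "\<Squnion>\<^bsub>Fi \<Sigma> X entails A\<^esub> ((\<lambda>a. generated_filter \<Sigma> X entails A {a}) ` F) = F"
  unfolding Fi_def
proof (rule inclusion_order_sup_eqI)
  have sub: "F \<subseteq> carrier A"
    using assms(2) by (simp add: l_filter_def)
  show "(\<lambda>a. generated_filter \<Sigma> X entails A {a}) ` F \<subseteq> {F. l_filter \<Sigma> X entails A F}"
    using l_filter_generated_filter[OF assms(1)] by auto
  show "F \<in> {F. l_filter \<Sigma> X entails A F}"
    using assms(2) by simp
  show "G \<subseteq> F" if "G \<in> (\<lambda>a. generated_filter \<Sigma> X entails A {a}) ` F" for G
    using that generated_filter_least[OF assms(2)] by auto
  show "F \<subseteq> G" if "\<And>H. H \<in> (\<lambda>a. generated_filter \<Sigma> X entails A {a}) ` F \<Longrightarrow> H \<subseteq> G" for G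
  proof
    fix a assume "a \<in> F"
    then show "a \<in> G"
      using that generated_filter_superset[of "{a}" A \<Sigma> X entails] sub by blast
  qed
qed

lemma presentable_lattice_Fi:
  assumes "is_logic \<Sigma> X entails" "cardinality_at_most entails \<kappa>" "\<kappa> \<le>o r"
  shows "presentable_lattice r (Fi \<Sigma> X entails A)"
  unfolding presentable_lattice_def
proof (intro conjI ballI)
  show "complete_lattice (Fi \<Sigma> X entails A)"
    unfolding Fi_def
  proof (rule complete_lattice_inclusion_order)
    show "{F. l_filter \<Sigma> X entails A F} \<subseteq> Pow (carrier A)"
      using carrier_Fi_subset unfolding carrier_Fi .
    show "carrier A \<inter> \<Inter>S \<in> {F. l_filter \<Sigma> X entails A F}"
      if "S \<subseteq> {F. l_filter \<Sigma> X entails A F}" for S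
      using l_filter_Inter[OF assms(1), of S A] that by blast
  qed
  fix F assume "F \<in> carrier (Fi \<Sigma> X entails A)"
  then have F: "l_filter \<Sigma> X entails A F"
    by (simp add: carrier_Fi)
  let ?S = "(\<lambda>a. generated_filter \<Sigma> X entails A {a}) ` F"
  have "small_in r (Fi \<Sigma> X entails A) s" if s: "s \<in> ?S" for s
  proof -
    obtain a where "a \<in> F" "s = generated_filter \<Sigma> X entails A {a}"
      using s by blast
    then show ?thesis
      using small_in_generated_filter[OF assms, of a A] l_filter_subset[OF F] by blast
  qed
  moreover have "F = \<Squnion>\<^bsub>Fi \<Sigma> X entails A\<^esub> ?S"
    by (rule Fi_sup_generated_filters[OF assms(1) F, symmetric])
  ultimately show "\<exists>S. (\<forall>s \<in> S. small_in r (Fi \<Sigma> X entails A) s) \<and> F = \<Squnion>\<^bsub>Fi \<Sigma> X entails A\<^esub> S"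
    by metis
qed

section \<open>Functoriality of taking preimages\<close>

lemma presentable_lattice_functor_Fi:
  fixes \<Sigma> :: "'f signature"
  assumes "is_logic \<Sigma> X entails" "cardinality_at_most entails \<kappa>" "\<kappa> \<le>o r"
  shows "presentable_lattice_functor r \<Sigma>
    (Fi \<Sigma> X entails :: ('f, 'a) alg \<Rightarrow> 'a set gorder) Fi_map"
  unfolding presentable_lattice_functor_def
proof (intro conjI allI impI ballI)
  fix M :: "('f, 'a) alg"
  show "presentable_lattice r (Fi \<Sigma> X entails M)"
    by (rule presentable_lattice_Fi[OF assms])
next
  fix M N :: "('f, 'a) alg" and h
  assume *: "is_algebra \<Sigma> M \<and> is_algebra \<Sigma> N \<and> h \<in> alg_hom \<Sigma> M N"
  show "Fi_map M N h \<in> carrier (Fi \<Sigma> X entails N) \<rightarrow> carrier (Fi \<Sigma> X entails M)"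
    using l_filter_preimage[OF assms(1)] * by (auto simp: carrier_Fi Fi_map_def)
  show "isotone (Fi \<Sigma> X entails N) (Fi \<Sigma> X entails M) (Fi_map M N h)"
    unfolding Fi_def by (rule isotone_inclusion_order) (auto simp: Fi_map_def)
next
  fix M :: "('f, 'a) alg" and F
  assume "F \<in> carrier (Fi \<Sigma> X entails M)"
  then have "F \<subseteq> carrier M"
    using carrier_Fi_subset by blast
  then show "Fi_map M M (restrict id (carrier M)) F = F"
    by (auto simp: Fi_map_def)
next
  fix M N P :: "('f, 'a) alg" and g h F
  assume "is_algebra \<Sigma> M \<and> is_algebra \<Sigma> N \<and> is_algebra \<Sigma> P \<and>
    h \<in> alg_hom \<Sigma> M N \<and> g \<in> alg_hom \<Sigma> N P"
  \<comment> \<open>Cutting the inner preimage down to \<open>carrier N\<close> loses nothing, since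
    \<open>h\<close> maps \<open>carrier M\<close> into \<open>carrier N\<close>.\<close>
  then show "Fi_map M P (compose (carrier M) g h) F = Fi_map M N h (Fi_map N P g F)"
    by (auto simp: Fi_map_def compose_def dest: alg_hom_in_carrier)
qed

section \<open>Assembly of the filter pair for \<open>reg \<kappa>\<close>\<close>

theorem theorem2p15:
  fixes \<Sigma> :: "'f signature"
    and X :: "'x set"
    and entails :: "('f, 'x) fm set \<Rightarrow> ('f, 'x) fm \<Rightarrow> bool"
    and \<kappa> :: "'k rel"
  assumes "Cinfinite \<kappa>"
    and "is_logic \<Sigma> X entails"
    and "cardinality_at_most entails \<kappa>"
  shows "is_filter_pair (reg \<kappa>) \<Sigma>
           (Fi \<Sigma> X entails :: ('f, 'a) alg \<Rightarrow> 'a set gorder) Fi_map Fi_incl"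
proof -
  have reg: "regular_cardinal (reg \<kappa>)" and le: "\<kappa> \<le>o reg \<kappa>"
    using least_regular_above_reg[OF assms(1)] unfolding least_regular_above_def by blast+
  note assms' = assms(2,3) le
  show ?thesis
    unfolding is_filter_pair_def
  proof (intro conjI allI impI ballI)
    show "regular_cardinal (reg \<kappa>)"
      by (rule reg)
    show "presentable_lattice_functor (reg \<kappa>) \<Sigma>
        (Fi \<Sigma> X entails :: ('f, 'a) alg \<Rightarrow> 'a set gorder) Fi_map"
      by (rule presentable_lattice_functor_Fi[OF assms'])
  next
    fix M :: "('f, 'a) alg"
    let ?L = "Fi \<Sigma> X entails M" and ?P = "powerset_lattice (carrier M)"
    \<comment> \<open>As the inclusion changes no set, preservation means that one family has the
      same infimum or supremum in both lattices.\<close>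
    have incl: "Fi_incl M ` S = S" for S
      by (auto simp: Fi_incl_def)
    note sub = carrier_Fi_subset[of \<Sigma> X entails M]
    show "Fi_incl M \<in> carrier ?L \<rightarrow> carrier ?P"
      using sub by (intro Pi_I) (simp add: powerset_lattice_def Fi_incl_def subset_iff)
    show "isotone ?L ?P (Fi_incl M)"
      unfolding Fi_def powerset_lattice_def
      by (rule isotone_inclusion_order) (simp add: Fi_incl_def)
    show "Fi_incl M (\<Sqinter>\<^bsub>?L\<^esub> S) = \<Sqinter>\<^bsub>?P\<^esub> (Fi_incl M ` S)" if "S \<subseteq> carrier ?L" for S
    proof -
      have "\<Sqinter>\<^bsub>?P\<^esub> S = carrier M \<inter> \<Inter>S"
        unfolding powerset_lattice_def
        by (rule inclusion_order_inf_eq_Inter) (use that sub in blast)+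
      then show ?thesis
        unfolding incl using Fi_inf[OF assms(2) that] by (simp add: Fi_incl_def)
    qed
    \<comment> \<open>In the powerset every supremum is a union; among filters this is where
      directedness and \<open>\<kappa> \<le>o reg \<kappa>\<close> enter.\<close>
    show "Fi_incl M (\<Squnion>\<^bsub>?L\<^esub> D) = \<Squnion>\<^bsub>?P\<^esub> (Fi_incl M ` D)" if "directed_in (reg \<kappa>) ?L D" for D
    proof -
      have "D \<subseteq> Pow (carrier M)"
        using that sub unfolding directed_in_def by blast
      then have "\<Squnion>\<^bsub>?P\<^esub> D = \<Union>D"
        unfolding powerset_lattice_def by (intro inclusion_order_sup_eq_Union) blast+
      then show ?thesis
        unfolding incl using Fi_sup_directed[OF assms(3) le that] by (simp add: Fi_incl_def)
    qed
  next
    fix M N :: "('f, 'a) alg" and h F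
    \<comment> \<open>Naturality is immediate, as \<open>Fi_map\<close> is itself the preimage cut
      down to the carrier.\<close>
    show "Fi_incl M (Fi_map M N h F) = h -` Fi_incl N F \<inter> carrier M"
      by (simp add: Fi_incl_def Fi_map_def)
  qed
qed

end
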